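(* Let $q$ be a prime power, $0<R<1$ and $0<\alpha<1/2$. Then there exist sequences of cyclic codes $\mathcal{C}_n$ over $\mathbb{F}_q$, of lengths $n\to\infty$, with rate $R$ and minimum distance $\Omega(n^{\alpha})$.
   Context: A cyclic code of length $n$ over $\mathbb{F}_q$ is an ideal of $\mathbb{F}_q[x]/(x^n-1)$, identified with a linear subspace of $\mathbb{F}_q^n$ via coefficient vectors of representatives of degree $<n$. For a sequence of linear codes with parameters $[n,k_n,d_n]$ (length, dimension, minimum Hamming distance), the rate is $\liminf_{n\to\infty} k_n/n$. *)

theory Defs
  imports
    "HOL-Algebra.Algebraic_Closure_Type"
    "HOL-Algebra.QuotRing"
    "HOL-Number_Theory.Prime_Powers"
    "HOL-Library.Function_Algebras"
    "HOL-Library.Landau_Symbols"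
    "HOL-Library.Extended_Real"
    "HOL-Library.Liminf_Limsup"
begin

text \<open>
  A word of length \<open>n\<close> is a function on \<open>nat\<close> that vanishes outside \<open>{..<n}\<close>. For a
  polynomial \<open>f\<close> of degree less than \<open>n\<close>, \<open>coeff f\<close> is therefore its coefficient vector of
  length \<open>n\<close>.
\<close>

definition word_scale :: "'a::field \<Rightarrow> (nat \<Rightarrow> 'a) \<Rightarrow> nat \<Rightarrow> 'a" where
  "word_scale c v = (\<lambda>i. c * v i)"

interpretation word: vector_space "word_scale :: 'a::field \<Rightarrow> _"
  by unfold_locales (auto simp: word_scale_def fun_eq_iff algebra_simps)

definition cyclic_modulus :: "nat \<Rightarrow> 'a::field poly set" where
  "cyclic_modulus n = PIdl\<^bsub>ring_of_type_algebra\<^esub> (monom 1 n - 1)"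

definition cyclic_ring :: "nat \<Rightarrow> 'a::field poly set ring" where
  "cyclic_ring n = ring_of_type_algebra Quot cyclic_modulus n"

definition cyclic_code :: "nat \<Rightarrow> (nat \<Rightarrow> 'a::field) set \<Rightarrow> bool" where
  "cyclic_code n C \<longleftrightarrow> n > 0 \<and>
     (\<exists>J. ideal J (cyclic_ring n) \<and>
          C = coeff ` {f. degree f < n \<and> cyclic_modulus n +>\<^bsub>ring_of_type_algebra\<^esub> f \<in> J})"

definition hamming_dist :: "nat \<Rightarrow> (nat \<Rightarrow> 'a) \<Rightarrow> (nat \<Rightarrow> 'a) \<Rightarrow> nat" where
  "hamming_dist n v w = card {i. i < n \<and> v i \<noteq> w i}"

text \<open>The minimum distance is meaningful only for codes with at least two words.\<close>

definition min_dist :: "nat \<Rightarrow> (nat \<Rightarrow> 'a) set \<Rightarrow> nat" where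
  "min_dist n C = Inf {hamming_dist n v w | v w. v \<in> C \<and> w \<in> C \<and> v \<noteq> w}"

definition code_rate :: "(nat \<Rightarrow> nat) \<Rightarrow> (nat \<Rightarrow> (nat \<Rightarrow> 'a::field) set) \<Rightarrow> ereal" where
  "code_rate len C = liminf (\<lambda>j. ereal (real (word.dim (C j)) / real (len j)))"

end

theory Submission
  imports Defs "HOL-Real_Asymp.Real_Asymp" "HOL-Number_Theory.Residues"
begin

text \<open>
  The codes are BCH codes. Let \<open>n = q\<^sup>m - 1\<close> and let \<open>\<beta>\<close> be a primitive \<open>n\<close>-th root of unity in
  the algebraic closure. The polynomials of degree less than \<open>n\<close> that vanish at
  \<open>\<beta>, \<beta>\<^sup>2, \<dots>\<close> up to exponent \<open>d - 1\<close> form a cyclic code of minimum distance at least \<open>d\<close>.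
  Its dimension is \<open>n\<close> for \<open>d = 1\<close>, is \<open>0\<close> for \<open>d = n + 1\<close>, and drops by at most \<open>m\<close> when \<open>d\<close>
  increases by one, since the additional syndrome lies in the field with \<open>q\<^sup>m\<close> elements. So some \<open>d\<close>
  has dimension between \<open>R n\<close> and \<open>R n + m\<close>, and then \<open>d\<close> is at least \<open>(1 - R) n / m\<close>. As \<open>m\<close> is
  logarithmic in \<open>n\<close>, the rate tends to \<open>R\<close> and the distance exceeds every power \<open>n\<^sup>\<alpha>\<close> with
  \<open>\<alpha> < 1\<close>.
\<close>

section \<open>Finite subfields and roots of unity in an algebraically closed field\<close>

text \<open>Since \<open>p\<close> splits into linear factors, a repeated factor would give a common
  root of \<open>p\<close> and \<open>pderiv p\<close>. The multiset of roots is therefore a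
  set.\<close>

lemma card_roots_of_separable:
  fixes p :: "'a::alg_closed_field poly"
  assumes "p \<noteq> 0" and separable: "\<And>x. poly p x = 0 \<Longrightarrow> poly (pderiv p) x \<noteq> 0"
  shows "card {x. poly p x = 0} = Polynomial.degree p"
proof -
  obtain A where A: "size A = Polynomial.degree p"
    "p = smult (Polynomial.lead_coeff p) (\<Prod>x\<in>#A. [:-x, 1:])"
    using alg_closed_imp_factorization[OF \<open>p \<noteq> 0\<close>] by blast
  define c where "c = Polynomial.lead_coeff p"
  have "c \<noteq> 0" using \<open>p \<noteq> 0\<close> by (simp add: c_def)
  have p: "p = smult c (\<Prod>x\<in>#A. [:-x, 1:])"
    using A(2) by (simp add: c_def)
  have roots: "{x. poly p x = 0} = set_mset A"
    using \<open>c \<noteq> 0\<close> by (auto simp: p poly_prod_mset prod_mset_zero_iff)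
  have "count A x = 1" if "x \<in># A" for x
  proof (rule ccontr)
    assume "count A x \<noteq> 1"
    obtain B where B: "A = add_mset x B"
      using \<open>x \<in># A\<close> by (metis insert_DiffM)
    with \<open>count A x \<noteq> 1\<close> have "x \<in># B"
      by (simp add: not_in_iff)
    then obtain D where D: "B = add_mset x D"
      by (metis insert_DiffM)
    define r where "r = (\<Prod>y\<in>#D. [:-y, 1:])"
    have "p = smult c ([:-x, 1:] * ([:-x, 1:] * r))"
      unfolding p B D r_def by simp
    hence "poly (pderiv p) x = 0"
      by (simp add: pderiv_mult pderiv_smult del: mult_pCons_left)
    moreover have "poly p x = 0"
      using roots \<open>x \<in># A\<close> by blast
    ultimately show False using separable by blast
  qed
  hence "size A = card (set_mset A)"
    by (simp add: size_multiset_overloaded_eq)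
  with roots A(1) show ?thesis by simp
qed

text \<open>The polynomial \<open>X ^ Q - X\<close> has derivative \<open>-1\<close> because
  \<open>Q\<close> vanishes in the field, so all its roots are simple.\<close>

lemma card_frobenius_fixed:
  assumes "of_nat Q = (0 :: 'a::alg_closed_field)" and "Q > 1"
  shows "card {x :: 'a. x ^ Q = x} = Q"
proof -
  define p :: "'a poly" where "p = Polynomial.monom 1 Q - Polynomial.monom 1 1"
  have deg: "Polynomial.degree p = Q"
    unfolding p_def diff_conv_add_uminus using assms(2)
    by (subst Polynomial.degree_add_eq_left) (simp_all add: degree_monom_eq)
  have "pderiv p = -1"
    using assms by (simp add: p_def pderiv_diff pderiv_monom monom_0 one_pCons)
  hence "card {x. poly p x = 0} = Q"
    using deg assms(2) by (subst card_roots_of_separable) auto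
  thus ?thesis
    by (simp add: p_def poly_monom)
qed

lemma nat_pow_ring_of_type_algebra:
  fixes x :: "'a::comm_ring_1"
  shows "x [^]\<^bsub>ring_of_type_algebra\<lparr>carrier := K\<rparr>\<^esub> (i :: nat) = x ^ i"
  by (induction i) (simp_all add: nat_pow_def ring_of_type_algebra_def mult.commute)

text \<open>The fixed points of \<open>x ^ Q\<close> form a subfield with \<open>Q\<close> elements,
  and the multiplicative group of a finite field is cyclic. Primitivity is phrased as distinctness
  of powers, the form that the BCH bound needs.\<close>

lemma ex_primitive_root_of_unity:
  assumes char: "prime CHAR('a::alg_closed_field)"
    and Q: "Q = CHAR('a) ^ k" "k > 0"
  shows "\<exists>\<beta>::'a. \<beta> ^ (Q - 1) = 1 \<and> inj_on (\<lambda>i. \<beta> ^ i) {..<Q - 1}"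
proof -
  define K where "K = {x::'a. x ^ Q = x}"
  define F where "F = (ring_of_type_algebra :: 'a ring)"
  interpret F: field F
    unfolding F_def by (rule field_from_type_algebra)
  have F_simps: "carrier F = UNIV" "monoid.mult F = (*)" "add F = (+)" "\<one>\<^bsub>F\<^esub> = 1" "\<zero>\<^bsub>F\<^esub> = 0"
    by (auto simp: F_def ring_of_type_algebra_def fun_eq_iff)
  have Q1: "Q > 1"
    unfolding Q(1) using prime_gt_1_nat[OF char] Q(2) by (rule one_less_power)
  have Q0: "of_nat Q = (0 :: 'a)"
    using Q by (simp add: zero_power)
  have card_K: "card K = Q"
    unfolding K_def by (rule card_frobenius_fixed[OF Q0 Q1])
  hence "finite K"
    using Q1 by (intro card_ge_0_finite) simp
  have add_K: "x + y \<in> K" if "x \<in> K" "y \<in> K" for x y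
    using that freshmans_dream'[OF char Q(1), of x y] by (simp add: K_def)
  have minus_K: "- x \<in> K" if "x \<in> K" for x
  proof -
    \<comment> \<open>Deriving the sign rule from additivity avoids splitting on the parity of
      \<open>Q\<close>.\<close>
    have "(x + - x) ^ Q = x ^ Q + (- x) ^ Q"
      by (rule freshmans_dream'[OF char Q(1)])
    hence "x ^ Q + (- x) ^ Q = 0"
      using Q1 by (simp add: zero_power)
    thus ?thesis
      using that by (simp add: K_def add_eq_0_iff)
  qed
  have neg: "\<ominus>\<^bsub>F\<^esub> x = - x" for x
    by (rule F.minus_equality) (simp_all add: F_simps)
  have inv: "inv\<^bsub>F\<^esub> x = inverse x" if "x \<noteq> 0" for x
    by (rule F.comm_inv_char) (use that in \<open>simp_all add: F_simps\<close>)
  have "subfield K F"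
  proof (rule F.subfieldI'[OF F.subringI])
    fix x assume "x \<in> K - {\<zero>\<^bsub>F\<^esub>}"
    thus "inv\<^bsub>F\<^esub> x \<in> K"
      by (simp add: F_simps inv) (simp add: K_def power_inverse)
  qed (auto simp: F_simps neg add_K minus_K, auto simp: K_def power_mult_distrib)
  then interpret K: field "F\<lparr>carrier := K\<rparr>"
    by (rule F.subfield_iff(2))
  have pow: "x [^]\<^bsub>F\<lparr>carrier := K\<rparr>\<^esub> (i :: nat) = x ^ i" for x i
    unfolding F_def by (rule nat_pow_ring_of_type_algebra)
  have "finite (carrier (F\<lparr>carrier := K\<rparr>))"
    using \<open>finite K\<close> by simp
  from K.finite_field_mult_group_has_gen[OF this]
  obtain a where a: "a \<in> K" "a \<noteq> 0" "K - {0} = {a ^ i | i::nat. i \<in> UNIV}"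
    unfolding pow by (auto simp: F_simps)
  have "a * a ^ (Q - 1) = a * 1"
    using a(1) Q1 by (simp add: K_def flip: power_Suc)
  hence a1: "a ^ (Q - 1) = 1"
    using a(2) by simp
  \<comment> \<open>The first \<open>Q - 1\<close> powers already exhaust the \<open>Q - 1\<close>
    nonzero elements, so by counting they are distinct.\<close>
  have "a ^ i = a ^ (i mod (Q - 1))" for i
  proof -
    have "a ^ i = a ^ ((Q - 1) * (i div (Q - 1)) + i mod (Q - 1))"
      by simp
    also have "\<dots> = a ^ (i mod (Q - 1))"
      by (simp only: power_add power_mult a1) simp
    finally show ?thesis .
  qed
  hence "{a ^ i | i::nat. i \<in> UNIV} = (\<lambda>i. a ^ i) ` {..<Q - 1}"
    using Q1 by (auto intro!: image_eqI[of _ _ "_ mod (Q - 1)"])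
  hence "card ((\<lambda>i. a ^ i) ` {..<Q - 1}) = card (K - {0})"
    using a(3) by simp
  also have "\<dots> = card {..<Q - 1}"
    using Q1 by (subst card_Diff_singleton) (simp_all add: card_K, simp add: K_def zero_power)
  finally have "inj_on (\<lambda>i. a ^ i) {..<Q - 1}"
    by (intro eq_card_imp_inj_on) simp_all
  with a1 show ?thesis by blast
qed

section \<open>Counting in finite fields and finite vector spaces\<close>

text \<open>Multiplication by a nonzero \<open>x\<close> permutes the nonzero elements, so their
  product can be cancelled. The extra factor \<open>x\<close> raises the exponent from one less than
  the cardinality to the cardinality itself.\<close>

lemma finite_field_power_card:
  fixes x :: "'a::{field,finite}"
  shows "x ^ card (UNIV :: 'a set) = x"
proof (cases "x = 0")
  case False
  have "x * (\<Prod>y\<in>UNIV-{0}. x * y) = x * x ^ (card (UNIV :: 'a set) - 1) * \<Prod>(UNIV-{0})"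
    by (simp add: prod.distrib mult_ac)
  also have "x * x ^ (card (UNIV :: 'a set) - 1) = x ^ card (UNIV :: 'a set)"
    using finite_UNIV_card_ge_0[where ?'a = 'a] by (simp flip: power_Suc)
  also have "(\<Prod>y\<in>UNIV-{0}. x * y) = \<Prod>(UNIV-{0})"
    by (rule prod.reindex_bij_witness[of _ "\<lambda>y. y / x" "\<lambda>y. x * y"]) (use False in auto)
  finally show ?thesis
    by simp
qed (use finite_UNIV_card_ge_0[where ?'a = 'a] in \<open>simp add: zero_power\<close>)

lemma card_eq_CHAR_power:
  assumes "primepow (card (UNIV :: 'a::{field,finite} set))"
  shows "prime CHAR('a)" and "\<exists>k>0. card (UNIV :: 'a set) = CHAR('a) ^ k"
proof -
  show pr: "prime CHAR('a)"
    using finite_imp_CHAR_pos[where ?'a = 'a] prime_CHAR_semidom by auto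
  obtain p k where pk: "prime p" "k > 0" "card (UNIV :: 'a set) = p ^ k"
    using assms by (auto simp: primepow_def)
  have "CHAR('a) dvd p ^ k"
    using CHAR_dvd_CARD[where ?'a = 'a] pk(3) by simp
  hence "CHAR('a) = p"
    using pr pk(1) by (meson prime_dvd_power primes_dvd_imp_eq)
  with pk show "\<exists>k>0. card (UNIV :: 'a set) = CHAR('a) ^ k" by blast
qed

text \<open>A new basis vector \<open>b\<close> multiplies the size by the number of scalars,
  because \<open>c\<close> and \<open>v\<close> are determined by
  \<open>scale c b + v\<close>.\<close>

lemma (in vector_space) card_span_independent:
  assumes "finite B" "independent B"
  shows "card (span B) = card (UNIV :: 'a set) ^ card B"
  using assms
proof (induction B rule: finite_induct)
  case (insert b B)
  have b: "b \<notin> span B" and B: "independent B"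
    using insert.prems insert.hyps by (simp_all add: independent_insert)
  let ?f = "\<lambda>(c, v). scale c b + v"
  have "bij_betw ?f (UNIV \<times> span B) (span (insert b B))"
  proof (rule bij_betw_imageI)
    show "inj_on ?f (UNIV \<times> span B)"
    proof (rule inj_onI, clarify)
      fix c v c' v'
      assume v: "v \<in> span B" "v' \<in> span B" and eq: "scale c b + v = scale c' b + v'"
      have "scale (c - c') b = v' - v"
        using eq by (simp add: scale_left_diff_distrib algebra_simps)
      hence "scale (c - c') b \<in> span B"
        using v by (simp add: span_diff)
      \<comment> \<open>If \<open>c\<close> and \<open>c'\<close> differed, rescaling by the inverse
        would put \<open>b\<close> into the span of \<open>B\<close>.\<close>
      from span_scale[OF this, of "inverse (c - c')"] have "c = c'"
        using b by (cases "c = c'") simp_all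
      with eq show "c = c' \<and> v = v'" by simp
    qed
    show "?f ` (UNIV \<times> span B) = span (insert b B)"
    proof (intro equalityI subsetI)
      fix x assume "x \<in> span (insert b B)"
      then obtain c where "x - scale c b \<in> span B"
        by (auto simp: span_insert)
      thus "x \<in> ?f ` (UNIV \<times> span B)"
        by (intro image_eqI[of _ _ "(c, x - scale c b)"]) simp_all
    qed (auto intro!: span_add span_scale intro: span_base subsetD[OF span_mono[of B]])
  qed
  hence "card (span (insert b B)) = card (UNIV :: 'a set) * card (span B)"
    by (simp add: bij_betw_same_card flip: card_cartesian_product)
  thus ?case
    using insert B by simp
qed simp

lemma (in vector_space) card_finite_subspace:
  assumes "subspace V" "finite V"
  shows "card V = card (UNIV :: 'a set) ^ dim V"
proof -
  obtain B where B: "B \<subseteq> V" "independent B" "V \<subseteq> span B" "card B = dim V"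
    by (rule basis_exists)
  hence "span B = V"
    using span_minimal[OF B(1) assms(1)] by blast
  moreover have "finite B"
    using B(1) assms(2) by (rule finite_subset)
  ultimately show ?thesis
    using card_span_independent[of B] B by simp
qed

text \<open>Subtracting a fixed element of a fibre injects that fibre into the kernel. This replaces
  rank-nullity and spares giving the syndrome field a vector space structure over the
  scalars.\<close>

lemma card_le_card_kernel_times:
  fixes s :: "'v::ab_group_add \<Rightarrow> 'w::ab_group_add"
  assumes "finite V" "finite K" "s ` V \<subseteq> K"
    and diff: "\<And>v w. v \<in> V \<Longrightarrow> w \<in> V \<Longrightarrow> v - w \<in> V"
    and s_diff: "\<And>v w. v \<in> V \<Longrightarrow> w \<in> V \<Longrightarrow> s (v - w) = s v - s w"
  shows "card V \<le> card K * card {v \<in> V. s v = 0}"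
proof -
  have fibre: "card {v \<in> V. s v = y} \<le> card {v \<in> V. s v = 0}" for y
  proof (cases "\<exists>v0\<in>V. s v0 = y")
    case True
    then obtain v0 where v0: "v0 \<in> V" "s v0 = y" by blast
    show ?thesis
      by (rule card_inj_on_le[of "\<lambda>v. v - v0"])
        (use v0 \<open>finite V\<close> in \<open>auto simp: diff s_diff inj_on_def\<close>)
  next
    case False
    hence "{v \<in> V. s v = y} = {}" by blast
    thus ?thesis by (metis card.empty le0)
  qed
  have "V = (\<Union>y\<in>K. {v \<in> V. s v = y})"
    using assms(3) by blast
  hence "card V = card (\<Union>y\<in>K. {v \<in> V. s v = y})"
    by (rule arg_cong)
  also have "\<dots> \<le> (\<Sum>y\<in>K. card {v \<in> V. s v = y})"
    using \<open>finite K\<close> by (rule card_UN_le)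
  also have "\<dots> \<le> card K * card {v \<in> V. s v = 0}"
    using sum_bounded_above[of K "\<lambda>y. card {v \<in> V. s v = y}"] fibre by auto
  finally show ?thesis .
qed

section \<open>BCH codes and their minimum distance\<close>

text \<open>This is evaluation of the word, read as a polynomial, at a point of the algebraic
  closure.\<close>

definition syndrome :: "nat \<Rightarrow> (nat \<Rightarrow> 'a::field) \<Rightarrow> 'a alg_closure \<Rightarrow> 'a alg_closure" where
  "syndrome n v x = (\<Sum>k<n. to_ac (v k) * x ^ k)"

text \<open>The narrow-sense BCH code of designed distance \<open>d\<close>: there are
  \<open>d - 1\<close> consecutive zeros, and none for \<open>d = 1\<close>.\<close>

definition bch_code :: "nat \<Rightarrow> 'a::field alg_closure \<Rightarrow> nat \<Rightarrow> (nat \<Rightarrow> 'a) set" where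
  "bch_code n \<beta> d = {v. (\<forall>i\<ge>n. v i = 0) \<and> (\<forall>i\<in>{1..<d}. syndrome n v (\<beta> ^ i) = 0)}"

lemma syndrome_0 [simp]: "syndrome n 0 x = 0"
  by (simp add: syndrome_def)

lemma syndrome_add: "syndrome n (v + w) x = syndrome n v x + syndrome n w x"
  by (simp add: syndrome_def algebra_simps sum.distrib)

lemma syndrome_diff: "syndrome n (v - w) x = syndrome n v x - syndrome n w x"
  by (simp add: syndrome_def algebra_simps sum_subtractf)

lemma syndrome_scale: "syndrome n (word_scale c v) x = to_ac c * syndrome n v x"
  by (simp add: syndrome_def word_scale_def sum_distrib_left mult_ac)

lemma syndrome_coeff:
  assumes "Polynomial.degree f < n"
  shows "syndrome n (Polynomial.coeff f) x = poly (map_poly to_ac f) x"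
proof -
  have "poly (map_poly to_ac f) x = (\<Sum>k\<le>Polynomial.degree f. to_ac (Polynomial.coeff f k) * x ^ k)"
    by (simp add: poly_altdef degree_map_poly coeff_map_poly)
  also have "\<dots> = (\<Sum>k<n. to_ac (Polynomial.coeff f k) * x ^ k)"
    by (rule sum.mono_neutral_left) (use assms in \<open>auto simp: Polynomial.coeff_eq_0\<close>)
  finally show ?thesis
    by (simp add: syndrome_def)
qed

lemma subspace_bch_code: "word.subspace (bch_code n \<beta> d)"
  by (rule word.subspaceI)
    (auto simp: bch_code_def syndrome_add syndrome_scale, auto simp: word_scale_def)

lemma bch_code_diff: "v \<in> bch_code n \<beta> d \<Longrightarrow> w \<in> bch_code n \<beta> d \<Longrightarrow> v - w \<in> bch_code n \<beta> d"
  by (rule word.subspace_diff[OF subspace_bch_code])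

text \<open>Words are total functions padded with zeros; restricting them gives extensional
  functions, which \<open>card_PiE\<close> counts.\<close>

lemma words_conv_PiE:
  "bij_betw (\<lambda>v. restrict v {..<n}) {v :: nat \<Rightarrow> 'a::zero. \<forall>i\<ge>n. v i = 0} ({..<n} \<rightarrow>\<^sub>E UNIV)"
  by (rule bij_betwI[where g = "\<lambda>w i. if i < n then w i else 0"])
    (auto simp: fun_eq_iff PiE_def extensional_def)

lemma card_words:
  "card {v :: nat \<Rightarrow> 'a::{zero,finite}. \<forall>i\<ge>n. v i = 0} = card (UNIV :: 'a set) ^ n"
  using bij_betw_same_card[OF words_conv_PiE[of n, where ?'a = 'a]] by (simp add: card_PiE)

lemma finite_words: "finite {v :: nat \<Rightarrow> 'a::{zero,finite}. \<forall>i\<ge>n. v i = 0}"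
  using bij_betw_finite[OF words_conv_PiE[of n, where ?'a = 'a]] by (simp add: finite_PiE)

lemma finite_bch_code: "finite (bch_code n (\<beta> :: 'a::{field,finite} alg_closure) d)"
  by (rule finite_subset[OF _ finite_words[of n]]) (auto simp: bch_code_def)

lemma card_bch_code:
  "card (bch_code n (\<beta> :: 'a::{field,finite} alg_closure) d) =
     card (UNIV :: 'a set) ^ word.dim (bch_code n \<beta> d)"
  by (rule word.card_finite_subspace[OF subspace_bch_code finite_bch_code])

text \<open>
  The syndromes at \<open>\<beta>, \<beta>\<^sup>2, \<dots>\<close> combine linearly to \<open>\<Sum>k. v k * \<beta>\<^sup>k * g (\<beta>\<^sup>k)\<close>
  for every polynomial \<open>g\<close> of degree at most \<open>d - 2\<close>; choosing \<open>g\<close> to vanish at all but one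
  of the support locators isolates a single letter of \<open>v\<close>.
\<close>
lemma bch_bound:
  assumes v: "v \<in> bch_code n \<beta> d" "v \<noteq> 0"
    and inj: "inj_on (\<lambda>i. \<beta> ^ i) {..<n}" and "\<beta> \<noteq> 0"
  shows "d \<le> card {i. i < n \<and> v i \<noteq> 0}"
proof (rule ccontr)
  assume less: "\<not> ?thesis"
  define S where "S = {i. i < n \<and> v i \<noteq> 0}"
  have "finite S" by (simp add: S_def)
  obtain s where "v s \<noteq> 0"
    using v(2) by (auto simp: fun_eq_iff)
  with v(1) have s: "s \<in> S"
    unfolding S_def bch_code_def by (auto simp: not_le[symmetric])
  define g where "g = (\<Prod>t\<in>S - {s}. [:- (\<beta> ^ t), 1:])"
  have "Polynomial.degree g = card S - 1"
    unfolding g_def using s \<open>finite S\<close> by (subst degree_prod_eq_sum_degree) simp_all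
  \<comment> \<open>The support has fewer than \<open>d\<close> elements, so \<open>g\<close> has
    degree at most \<open>d - 2\<close>. The shift by one is there because the zeros start at
    exponent 1.\<close>
  hence deg: "Suc j \<in> {1..<d}" if "j \<le> Polynomial.degree g" for j
    using that less s \<open>finite S\<close> card_gt_0_iff[of S] by (auto simp: S_def)
  have poly_g: "poly g x = (\<Prod>t\<in>S - {s}. x - \<beta> ^ t)" for x
    by (simp add: g_def poly_prod)
  have "0 = (\<Sum>j\<le>Polynomial.degree g. Polynomial.coeff g j * syndrome n v (\<beta> ^ Suc j))"
    using v(1) deg by (simp add: bch_code_def del: power_Suc)
  also have "\<dots> = (\<Sum>k<n. \<Sum>j\<le>Polynomial.degree g.
      Polynomial.coeff g j * (to_ac (v k) * (\<beta> ^ Suc j) ^ k))"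
    by (subst sum.swap) (simp add: syndrome_def sum_distrib_left)
  \<comment> \<open>The shift leaves the nonzero factor \<open>\<beta> ^ k\<close> beside the value
    of \<open>g\<close>.\<close>
  also have "\<dots> = (\<Sum>k<n. to_ac (v k) * \<beta> ^ k * poly g (\<beta> ^ k))"
    by (simp add: poly_altdef sum_distrib_left power_mult_distrib mult_ac flip: power_mult)
  also have "\<dots> = (\<Sum>k\<in>{s}. to_ac (v k) * \<beta> ^ k * poly g (\<beta> ^ k))"
  proof (rule sum.mono_neutral_right)
    show "\<forall>k\<in>{..<n} - {s}. to_ac (v k) * \<beta> ^ k * poly g (\<beta> ^ k) = 0"
      using \<open>finite S\<close> by (auto simp: poly_g S_def)
  qed (use s in \<open>auto simp: S_def\<close>)
  finally have "poly g (\<beta> ^ s) = 0"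
    using \<open>v s \<noteq> 0\<close> \<open>\<beta> \<noteq> 0\<close> by simp
  then obtain t where "t \<in> S - {s}" "\<beta> ^ s = \<beta> ^ t"
    using \<open>finite S\<close> by (auto simp: poly_g)
  with inj s show False
    by (auto simp: S_def dest: inj_onD)
qed

text \<open>The nonzero word \<open>v\<close> makes the set of distances nonempty, so the infimum is
  attained; by linearity the two closest words differ by a nonzero codeword.\<close>

lemma bch_code_min_dist:
  assumes "inj_on (\<lambda>i. \<beta> ^ i) {..<n}" "\<beta> \<noteq> 0" and "v \<in> bch_code n \<beta> d" "v \<noteq> 0"
  shows "d \<le> min_dist n (bch_code n \<beta> d)"
proof -
  let ?D = "{hamming_dist n v w | v w. v \<in> bch_code n \<beta> d \<and> w \<in> bch_code n \<beta> d \<and> v \<noteq> w}"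
  have "0 \<in> bch_code n \<beta> d"
    by (rule word.subspace_0[OF subspace_bch_code])
  hence "?D \<noteq> {}"
    using assms(3,4) by blast
  hence "min_dist n (bch_code n \<beta> d) \<in> ?D"
    unfolding min_dist_def by (rule Inf_nat_def1)
  then obtain v w where vw: "v \<in> bch_code n \<beta> d" "w \<in> bch_code n \<beta> d" "v \<noteq> w"
    "min_dist n (bch_code n \<beta> d) = hamming_dist n v w" by blast
  moreover have "hamming_dist n v w = card {i. i < n \<and> (v - w) i \<noteq> 0}"
    by (simp add: hamming_dist_def)
  ultimately show ?thesis
    using bch_bound[OF bch_code_diff[OF vw(1,2)] _ assms(1,2)] by simp
qed

section \<open>Cyclicity\<close>

text \<open>By the ideal correspondence, \<open>I\<close> maps to an ideal of the quotient. As
  \<open>I\<close> contains the modulus ideal, a coset lies in the image exactly when its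
  representatives lie in \<open>I\<close>.\<close>

lemma cyclic_code_of_ideal:
  fixes I :: "'a::field poly set"
  assumes "n > 0" and I: "ideal I ring_of_type_algebra" and "Polynomial.monom 1 n - 1 \<in> I"
  shows "cyclic_code n (Polynomial.coeff ` {f. Polynomial.degree f < n \<and> f \<in> I})"
proof -
  define P where "P = (ring_of_type_algebra :: 'a poly ring)"
  interpret P: cring P
    unfolding P_def by (rule cring_from_type_algebra)
  have P_simps: "carrier P = UNIV" "add P = (+)"
    by (auto simp: P_def ring_of_type_algebra_def fun_eq_iff)
  interpret I: ideal I P
    using I by (simp add: P_def)
  define M where "M = (cyclic_modulus n :: 'a poly set)"
  have M: "ideal M P"
    unfolding M_def cyclic_modulus_def P_def[symmetric]
    by (rule P.cgenideal_ideal) (simp add: P_simps)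
  then interpret M: ideal M P .
  have "M \<subseteq> I"
    unfolding M_def cyclic_modulus_def P_def[symmetric]
    by (rule P.cgenideal_minimal[OF I.ideal_axioms assms(3)])
  define J where "J = (\<lambda>f. M +>\<^bsub>P\<^esub> f) ` I"
  have J: "ideal J (cyclic_ring n)"
    unfolding J_def cyclic_ring_def M_def[symmetric] P_def[symmetric]
    by (rule P.ring_ideal_imp_quot_ideal[OF M I.ideal_axioms])
  have "M +>\<^bsub>P\<^esub> f \<in> J \<longleftrightarrow> f \<in> I" for f
  proof
    assume "M +>\<^bsub>P\<^esub> f \<in> J"
    then obtain g where g: "g \<in> I" "M +>\<^bsub>P\<^esub> f = M +>\<^bsub>P\<^esub> g"
      by (auto simp: J_def)
    have "f \<in> M +>\<^bsub>P\<^esub> f"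
      by (rule M.a_rcos_self) (simp add: P_simps)
    with g(2) obtain h where "h \<in> M" "f = h \<oplus>\<^bsub>P\<^esub> g"
      unfolding a_r_coset_def' by auto
    thus "f \<in> I"
      using g(1) \<open>M \<subseteq> I\<close> I.a_closed by auto
  qed (auto simp: J_def)
  hence "Polynomial.coeff ` {f. Polynomial.degree f < n \<and> f \<in> I} =
      Polynomial.coeff ` {f. Polynomial.degree f < n \<and> M +>\<^bsub>P\<^esub> f \<in> J}"
    by simp
  with J \<open>n > 0\<close> show ?thesis
    unfolding cyclic_code_def M_def P_def by blast
qed

lemma poly_map_to_ac_add:
  "poly (map_poly to_ac (f + g)) x = poly (map_poly to_ac f) x + poly (map_poly to_ac g) x"
proof -
  have "map_poly to_ac (f + g) = map_poly to_ac f + map_poly to_ac g"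
    by (rule poly_eqI) (simp add: coeff_map_poly)
  thus ?thesis by simp
qed

lemma poly_map_to_ac_mult:
  "poly (map_poly to_ac (f * g)) x = poly (map_poly to_ac f) x * poly (map_poly to_ac g) x"
proof (induction f)
  case (pCons a f)
  have "map_poly to_ac (smult a g) = smult (to_ac a) (map_poly to_ac g)"
    by (rule poly_eqI) (simp add: coeff_map_poly)
  with pCons show ?case
    by (simp add: poly_map_to_ac_add map_poly_pCons algebra_simps)
qed simp

lemma poly_map_to_ac_monom_minus_1:
  fixes x :: "'a::field alg_closure"
  shows "poly (map_poly to_ac (Polynomial.monom 1 n - 1)) x = x ^ n - 1"
proof -
  have "map_poly to_ac (Polynomial.monom (1 :: 'a) n - 1) = Polynomial.monom 1 n - 1"
    by (rule poly_eqI) (simp add: coeff_map_poly)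
  thus ?thesis by (simp add: poly_monom)
qed

lemma ideal_vanishing_polys:
  "ideal {f. \<forall>x\<in>A. poly (map_poly to_ac f) x = 0} (ring_of_type_algebra :: 'a::field poly ring)"
proof -
  define I where "I = {f :: 'a poly. \<forall>x\<in>A. poly (map_poly to_ac f) x = 0}"
  define P where "P = (ring_of_type_algebra :: 'a poly ring)"
  interpret P: ring P
    unfolding P_def by (rule ring_from_type_algebra)
  have P_simps: "carrier P = UNIV" "monoid.mult P = (*)" "add P = (+)" "\<zero>\<^bsub>P\<^esub> = 0"
    by (auto simp: P_def ring_of_type_algebra_def fun_eq_iff)
  have minus: "\<ominus>\<^bsub>P\<^esub> f = - f" for f
    by (rule P.minus_equality) (simp_all add: P_simps)
  have neg: "poly (map_poly to_ac (- f)) x = - poly (map_poly to_ac f) x" for f :: "'a poly" and x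
    using poly_map_to_ac_add[of f "- f" x] by (simp add: eq_neg_iff_add_eq_0 add.commute)
  have "ideal I P"
  proof (rule idealI)
    show "subgroup I (add_monoid P)"
    proof (rule P.add.subgroupI)
      have "0 \<in> I" by (simp add: I_def)
      thus "I \<noteq> {}" by blast
    qed (auto simp: minus P_simps I_def neg poly_map_to_ac_add)
  qed (auto simp: P_simps I_def poly_map_to_ac_mult P.ring_axioms)
  thus ?thesis by (simp add: I_def P_def)
qed

text \<open>Positivity of \<open>n\<close> matters for the zero word: the zero polynomial has degree
  0.\<close>

lemma ex_coeff_eq_word:
  assumes "n > 0" "\<forall>i\<ge>n. v i = 0"
  shows "\<exists>f. Polynomial.degree f < n \<and> Polynomial.coeff f = v"
proof -
  have v: "Polynomial.coeff (Abs_poly v) = v"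
    by (rule coeff_Abs_poly[of n]) (use assms in auto)
  hence "Polynomial.degree (Abs_poly v) < n"
    using assms by (intro degree_lessI) auto
  with v show ?thesis by blast
qed

text \<open>The code consists of the coefficient vectors of the polynomials vanishing at the powers
  of \<beta>. These powers are \<open>n\<close>-th roots of unity, so \<open>x ^ n - 1\<close> is
  among the vanishing polynomials.\<close>

lemma cyclic_code_bch_code:
  assumes "n > 0" "\<beta> ^ n = 1"
  shows "cyclic_code n (bch_code n \<beta> d)"
proof -
  let ?X = "(\<lambda>i. \<beta> ^ i) ` {1..<d}"
  let ?I = "{f. \<forall>x\<in>?X. poly (map_poly to_ac f) x = 0}"
  have "Polynomial.monom 1 n - 1 \<in> ?I"
    using assms(2)
    by (auto simp: poly_map_to_ac_monom_minus_1 power_mult[symmetric] mult.commute[of _ n])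
      (simp add: power_mult)
  hence "cyclic_code n (Polynomial.coeff ` {f. Polynomial.degree f < n \<and> f \<in> ?I})"
    by (rule cyclic_code_of_ideal[OF assms(1) ideal_vanishing_polys])
  moreover have "Polynomial.coeff ` {f. Polynomial.degree f < n \<and> f \<in> ?I} = bch_code n \<beta> d"
  proof (intro equalityI subsetI)
    fix v assume v: "v \<in> bch_code n \<beta> d"
    then obtain f where "Polynomial.degree f < n" "Polynomial.coeff f = v"
      using ex_coeff_eq_word[OF assms(1), of v] by (auto simp: bch_code_def)
    with v show "v \<in> Polynomial.coeff ` {f. Polynomial.degree f < n \<and> f \<in> ?I}"
      by (auto simp: bch_code_def syndrome_coeff)
  qed (auto simp: bch_code_def syndrome_coeff Polynomial.coeff_eq_0)
  ultimately show ?thesis by simp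
qed

section \<open>Dimension of BCH codes\<close>

text \<open>Raising to this power is additive, being an iterate of Frobenius, and it fixes both the
  letters of \<open>v\<close> and the point \<open>x\<close>.\<close>

lemma syndrome_frobenius:
  fixes v :: "nat \<Rightarrow> 'a::{field,finite}"
  assumes "prime CHAR('a)" "card (UNIV :: 'a set) ^ m = CHAR('a) ^ k"
    and x: "x ^ (card (UNIV :: 'a set) ^ m) = x"
  shows "syndrome n v x ^ (card (UNIV :: 'a set) ^ m) = syndrome n v x"
proof -
  let ?Q = "card (UNIV :: 'a set) ^ m"
  have c: "c ^ ?Q = c" for c :: 'a
    by (induction m) (simp_all add: power_mult finite_field_power_card)
  have "syndrome n v x ^ ?Q = (\<Sum>i<n. (to_ac (v i) * x ^ i) ^ ?Q)"
    unfolding syndrome_def by (rule freshmans_dream_sum') (use assms in simp_all)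
  also have "\<dots> = (\<Sum>i<n. to_ac (v i) * x ^ i)"
  proof (rule sum.cong)
    fix i
    have "(to_ac (v i) * x ^ i) ^ ?Q = to_ac (v i ^ ?Q) * (x ^ ?Q) ^ i"
      by (simp add: power_mult_distrib mult.commute flip: power_mult)
    thus "(to_ac (v i) * x ^ i) ^ ?Q = to_ac (v i) * x ^ i" by (simp only: c x)
  qed simp
  finally show ?thesis
    by (simp add: syndrome_def)
qed

text \<open>The next code is the kernel of the syndrome at \<open>\<beta> ^ d\<close>, whose values
  lie in a field with as many elements as a space of dimension \<open>m\<close>. Comparing
  cardinalities bounds the loss of dimension.\<close>

lemma dim_bch_code_Suc:
  fixes \<beta> :: "'a::{field,finite} alg_closure"
  assumes "primepow (card (UNIV :: 'a set))" "m > 0"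
    and \<beta>: "\<beta> ^ (card (UNIV :: 'a set) ^ m) = \<beta>" and "d > 0"
  shows "word.dim (bch_code n \<beta> d) \<le> m + word.dim (bch_code n \<beta> (Suc d))"
proof -
  let ?q = "card (UNIV :: 'a set)"
  define K where "K = {x :: 'a alg_closure. x ^ (?q ^ m) = x}"
  obtain k where k: "prime CHAR('a)" "k > 0" "?q = CHAR('a) ^ k"
    using card_eq_CHAR_power[OF assms(1)] by blast
  have "?q > 1"
    using assms(1) by (rule primepow_gt_Suc_0[unfolded One_nat_def[symmetric]])
  hence Q: "?q ^ m > 1"
    using \<open>m > 0\<close> by (rule one_less_power)
  have "of_nat (?q ^ m) = (0 :: 'a alg_closure)"
    using k(2) \<open>m > 0\<close> by (simp add: k(3) of_nat_eq_0_iff_char_dvd)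
  hence card_K: "card K = ?q ^ m"
    unfolding K_def by (rule card_frobenius_fixed[OF _ Q])
  hence "finite K"
    using Q card_K by (intro card_ge_0_finite) linarith
  have "(\<beta> ^ d) ^ (?q ^ m) = \<beta> ^ d"
    using \<beta> by (metis mult.commute power_mult)
  hence "syndrome n v (\<beta> ^ d) \<in> K" for v
    unfolding K_def mem_Collect_eq
    by (rule syndrome_frobenius[OF k(1), of m "k * m", rotated]) (simp add: k(3) power_mult)
  hence "(\<lambda>v. syndrome n v (\<beta> ^ d)) ` bch_code n \<beta> d \<subseteq> K"
    by blast
  hence "card (bch_code n \<beta> d) \<le>
      card K * card {v \<in> bch_code n \<beta> d. syndrome n v (\<beta> ^ d) = 0}"
    by (intro card_le_card_kernel_times finite_bch_code \<open>finite K\<close> bch_code_diff syndrome_diff)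
  \<comment> \<open>For positive \<open>d\<close> the new exponent is exactly \<open>d\<close>; for
    \<open>d = 0\<close> no condition would be added.\<close>
  also have "{v \<in> bch_code n \<beta> d. syndrome n v (\<beta> ^ d) = 0} = bch_code n \<beta> (Suc d)"
    using \<open>d > 0\<close> by (auto simp: bch_code_def less_Suc_eq)
  finally have "?q ^ word.dim (bch_code n \<beta> d) \<le> ?q ^ (m + word.dim (bch_code n \<beta> (Suc d)))"
    by (simp add: card_bch_code card_K power_add)
  thus ?thesis
    using \<open>?q > 1\<close> by (simp add: power_increasing_iff)
qed

lemma dim_bch_code_1:
  assumes "card (UNIV :: 'a::{field,finite} set) > 1"
  shows "word.dim (bch_code n (\<beta> :: 'a alg_closure) 1) = n"
proof -
  have "bch_code n \<beta> 1 = {v. \<forall>i\<ge>n. v i = 0}"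
    by (simp add: bch_code_def)
  hence "card (UNIV :: 'a set) ^ word.dim (bch_code n \<beta> 1) = card (UNIV :: 'a set) ^ n"
    using card_bch_code[of n \<beta> 1] card_words[of n, where ?'a = 'a] by metis
  thus ?thesis
    using assms by (simp add: power_inject_exp)
qed

section \<open>Choice of the designed distance\<close>

lemma ex_cyclic_code:
  fixes R :: real
  assumes "primepow (card (UNIV :: 'a::{field,finite} set))" and "m > 0" and "0 < R" "R < 1"
    and n: "n = card (UNIV :: 'a set) ^ m - 1"
  shows "\<exists>C :: (nat \<Rightarrow> 'a) set. cyclic_code n C \<and>
    R * n \<le> word.dim C \<and> word.dim C \<le> R * n + m \<and> (1 - R) * n \<le> real m * min_dist n C"
proof -
  let ?q = "card (UNIV :: 'a set)"
  obtain k where k: "prime CHAR('a)" "k > 0" "?q = CHAR('a) ^ k"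
    using card_eq_CHAR_power[OF assms(1)] by blast
  have q: "?q > 1"
    using assms(1) by (rule primepow_gt_Suc_0[unfolded One_nat_def[symmetric]])
  have Q: "?q ^ m > 1"
    using q \<open>m > 0\<close> by (rule one_less_power)
  hence "n > 0" by (simp add: n)
  obtain \<beta> :: "'a alg_closure" where \<beta>: "\<beta> ^ n = 1" "inj_on (\<lambda>i. \<beta> ^ i) {..<n}"
    using ex_primitive_root_of_unity[where ?'a = "'a alg_closure", of "?q ^ m" "k * m"] k \<open>m > 0\<close>
    by (auto simp: n power_mult)
  have "\<beta> \<noteq> 0"
    using \<beta>(1) \<open>n > 0\<close> by (auto simp: zero_power)
  have "?q ^ m = Suc n"
    using Q by (simp add: n)
  hence "\<beta> ^ (?q ^ m) = \<beta>"
    using \<beta>(1) by simp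
  note step = dim_bch_code_Suc[OF assms(1,2) this, of _ n]
  let ?k = "\<lambda>d. word.dim (bch_code n \<beta> d)"
  \<comment> \<open>A nonzero word of this code would have weight exceeding its length.\<close>
  have "bch_code n \<beta> (Suc n) = {0}"
  proof -
    have "v = 0" if "v \<in> bch_code n \<beta> (Suc n)" for v
    proof (rule ccontr)
      assume "v \<noteq> 0"
      with that have "Suc n \<le> card {i. i < n \<and> v i \<noteq> 0}"
        by (rule bch_bound[OF _ _ \<beta>(2) \<open>\<beta> \<noteq> 0\<close>])
      also have "\<dots> \<le> card {..<n}"
        by (intro card_mono) auto
      finally show False by simp
    qed
    thus ?thesis
      using word.subspace_0[OF subspace_bch_code, of n \<beta> "Suc n"] by blast
  qed
  hence "?q ^ ?k (Suc n) = 1"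
    unfolding card_bch_code[symmetric] by simp
  hence "?k (Suc n) = 0"
    using q by simp
  hence "\<exists>e. real (?k (Suc e)) < R * n"
    using \<open>n > 0\<close> \<open>0 < R\<close> by (intro exI[of _ n]) simp
  moreover have "\<not> real (?k (Suc 0)) < R * n"
    using dim_bch_code_1[OF q, of n \<beta>] mult_right_mono[of R 1 "real n"] \<open>R < 1\<close> by simp
  \<comment> \<open>Here \<open>Suc e\<close> is a designed distance just before the dimension falls
    below \<open>R * n\<close>; indexing by \<open>Suc\<close> starts the search at distance 1,
    where the dimension is \<open>n\<close>.\<close>
  ultimately obtain e where e: "\<not> real (?k (Suc e)) < R * n" "real (?k (Suc (Suc e))) < R * n"
    using exists_least_lemma[of "\<lambda>e. real (?k (Suc e)) < R * n"] by auto
  define d where "d = Suc e"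
  have d: "R * n \<le> ?k d" "real (?k (Suc d)) < R * n" "d > 0"
    using e by (simp_all add: d_def)
  have iter: "n \<le> i * m + ?k (Suc i)" for i
  proof (induction i)
    case 0
    thus ?case using dim_bch_code_1[OF q, of n \<beta>] by simp
  next
    case (Suc i)
    thus ?case using step[of "Suc i"] by simp
  qed
  have "real n \<le> real (d * m + ?k (Suc d))"
    using iter[of d] by (simp only: of_nat_le_iff)
  \<comment> \<open>The \<open>d\<close> steps from distance 1 to \<open>Suc d\<close> lose at most
    \<open>d * m\<close> dimensions, yet bring the dimension below \<open>R * n\<close>.\<close>
  hence "real n < real d * m + R * n"
    using d(2) by simp
  hence dm: "(1 - R) * n \<le> real m * d"
    by (simp add: algebra_simps)
  have "real (?k d) \<le> real (m + ?k (Suc d))"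
    using step[OF d(3)] by (simp only: of_nat_le_iff)
  hence upper: "?k d \<le> R * n + m"
    using d(2) by simp
  \<comment> \<open>Positive dimension supplies a nonzero codeword, without which the minimum
    distance would be meaningless.\<close>
  have "0 < R * n"
    using \<open>n > 0\<close> \<open>0 < R\<close> by simp
  hence "?k d > 0"
    using d(1) by linarith
  hence "card (bch_code n \<beta> d) > 1"
    unfolding card_bch_code by (intro one_less_power q)
  hence "\<not> bch_code n \<beta> d \<subseteq> {0}"
    using card_mono[of "{0}" "bch_code n \<beta> d"] by auto
  then obtain v where "v \<in> bch_code n \<beta> d" "v \<noteq> 0" by blast
  hence "d \<le> min_dist n (bch_code n \<beta> d)"
    by (rule bch_code_min_dist[OF \<beta>(2) \<open>\<beta> \<noteq> 0\<close>])
  hence "real m * d \<le> real m * min_dist n (bch_code n \<beta> d)"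
    by (intro mult_left_mono) simp_all
  with dm have "(1 - R) * n \<le> real m * min_dist n (bch_code n \<beta> d)"
    by linarith
  with cyclic_code_bch_code[OF \<open>n > 0\<close> \<beta>(1)] d(1) upper show ?thesis
    by blast
qed

section \<open>Asymptotics of rate and distance\<close>

theorem theorem2:
  fixes q :: nat and R \<alpha> :: real
  assumes "primepow q" and "card (UNIV :: 'a::{field,finite} set) = q"
    and "0 < R" and "R < 1"
    and "0 < \<alpha>" and "\<alpha> < 1/2"
  shows "\<exists>(len :: nat \<Rightarrow> nat) (C :: nat \<Rightarrow> (nat \<Rightarrow> 'a) set).
           strict_mono len \<and>
           (\<forall>j. cyclic_code (len j) (C j)) \<and>
           code_rate len C = ereal R \<and>
           (\<lambda>j. real (min_dist (len j) (C j))) \<in> \<Omega>(\<lambda>j. real (len j) powr \<alpha>)"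
proof -
  have q: "q > 1"
    using assms(1) by (rule primepow_gt_Suc_0[unfolded One_nat_def[symmetric]])
  \<comment> \<open>The extension degree is \<open>Suc j\<close>, so it is positive and every length
    is positive.\<close>
  define len where "len = (\<lambda>j. q ^ Suc j - 1)"
  have "\<exists>C :: (nat \<Rightarrow> 'a) set. cyclic_code (len j) C \<and>
      R * len j \<le> word.dim C \<and> word.dim C \<le> R * len j + Suc j \<and>
      (1 - R) * len j \<le> real (Suc j) * min_dist (len j) C" for j
    by (rule ex_cyclic_code) (use assms in \<open>simp_all add: len_def\<close>)
  then obtain C :: "nat \<Rightarrow> (nat \<Rightarrow> 'a) set" where C: "\<And>j. cyclic_code (len j) (C j)"
    "\<And>j. R * len j \<le> word.dim (C j)" "\<And>j. word.dim (C j) \<le> R * len j + Suc j"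
    "\<And>j. (1 - R) * len j \<le> real (Suc j) * min_dist (len j) (C j)"
    by metis
  have len_pos: "len j > 0" for j
    using one_less_power[OF q, of "Suc j"] by (simp add: len_def)
  have real_len: "real (len j) = real q ^ Suc j - 1" for j
    using q by (simp add: len_def of_nat_diff)
  have "strict_mono len"
    unfolding strict_mono_Suc_iff
  proof
    show "len j < len (Suc j)" for j
      unfolding len_def using q len_pos[of j]
      by (intro diff_less_mono power_strict_increasing) (simp_all add: len_def)
  qed
  have rq: "real q > 1" using q by simp
  \<comment> \<open>The dimension exceeds \<open>R * len j\<close> by at most \<open>Suc j\<close>,
    so this limit forces the rate to be \<open>R\<close>.\<close>
  have lim: "(\<lambda>j. real (Suc j) / real (len j)) \<longlonglongrightarrow> 0"
    unfolding real_len using rq by real_asymp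
  have "(\<lambda>j. real (word.dim (C j)) / len j) \<longlonglongrightarrow> R"
  proof (rule tendsto_sandwich)
    show "\<forall>\<^sub>F j in sequentially. R \<le> real (word.dim (C j)) / len j"
      using C(2) len_pos by (simp add: field_simps)
    show "\<forall>\<^sub>F j in sequentially. real (word.dim (C j)) / len j \<le> R + real (Suc j) / real (len j)"
      using C(3) len_pos by (simp add: field_simps)
    show "(\<lambda>j. R + real (Suc j) / real (len j)) \<longlonglongrightarrow> R"
      using tendsto_add[OF tendsto_const lim, of R] by simp
  qed simp
  hence "code_rate len C = ereal R"
    unfolding code_rate_def by (intro lim_imp_Liminf) auto
  \<comment> \<open>The exponent \<alpha> is below 1, so the exponential length absorbs the linear
    factor lost in the distance bound.\<close>
  have "(\<lambda>j. real (Suc j) * real (len j) powr \<alpha> / real (len j)) \<longlonglongrightarrow> 0"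
    unfolding real_len using rq assms(5,6) by real_asymp
  hence "\<forall>\<^sub>F j in sequentially. real (Suc j) * real (len j) powr \<alpha> / real (len j) < 1"
    by (rule order_tendstoD) simp
  hence "\<forall>\<^sub>F j in sequentially.
      (1 - R) * norm (real (len j) powr \<alpha>) \<le> norm (real (min_dist (len j) (C j)))"
  proof eventually_elim
    case (elim j)
    \<comment> \<open>Both sides are scaled by \<open>Suc j\<close> to match the distance bound;
      cancelling it leaves \<open>1 - R\<close> as the implied constant.\<close>
    have "real (Suc j) * ((1 - R) * len j powr \<alpha>) = (1 - R) * (real (Suc j) * len j powr \<alpha>)"
      by (simp only: mult_ac)
    also have "\<dots> \<le> (1 - R) * len j"
      using elim len_pos[of j] \<open>R < 1\<close> by (intro mult_left_mono) (simp_all add: field_simps)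
    also have "\<dots> \<le> real (Suc j) * min_dist (len j) (C j)"
      by (rule C(4))
    finally show ?case
      by (subst (asm) mult_le_cancel_left_pos) simp_all
  qed
  hence "(\<lambda>j. real (min_dist (len j) (C j))) \<in> \<Omega>(\<lambda>j. real (len j) powr \<alpha>)"
    using \<open>R < 1\<close> by (intro landau_omega.bigI[of "1 - R"]) simp_all
  with \<open>strict_mono len\<close> C(1) \<open>code_rate len C = ereal R\<close> show ?thesis
    by blast
qed

end
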